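(* Let $f:\mathbb{R}^d\to\mathbb{R}$ be convex, and let $\mathcal{G}(\mathbf{x};\xi)$ be a stochastic subgradient of $f$ with $\|\mathcal{G}(\mathbf{x};\xi)\|\le M$ for all $\mathbf{x}$ and $\xi$. Let $\mathbf{x}_*$ be a minimizer of $f$, let $\alpha>0$, $\beta\in[0,1)$, $s\ge0$ with $s\beta\ge 1/2$, let $t\ge0$ be an integer, and let $\{\mathbf{x}_k\}$ be generated by the stochastic unified momentum (SUM) method started at $\mathbf{x}_0$ with parameters $\alpha,\beta,s$. Put $\mathcal{G}_k=\mathcal{G}(\mathbf{x}_k;\xi_k)$ for $k\ge0$, $\mathcal{G}_{-1}=0$, and $\widehat{\mathbf{x}}_t=\frac{1}{t+1}\sum_{k=0}^t\mathbf{x}_k$. Then $$\mathrm{E}[f(\widehat{\mathbf{x}}_t)-f(\mathbf{x}_* )]\le\frac{\beta(f(\mathbf{x}_0)-f(\mathbf{x}_* ))}{(1-\beta)(t+1)}+\frac{(1-\beta)\|\mathbf{x}_0-\mathbf{x}_*\|^2}{2\alpha(t+1)}+\frac{s\alpha\beta M}{1-\beta}\cdot\frac{\mathrm{E}\left[\sum_{k=0}^t\|\mathcal{G}_k-\mathcal{G}_{k-1}\|\right]}{t+1}.$$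
   Context: $\|\cdot\|$ is the Euclidean norm and $\partial f(\mathbf{x})$ is the set of subgradients of $f$ at $\mathbf{x}$. Stochastic subgradient: $\xi_0,\xi_1,\dots$ are independent random variables distributed as $\xi$, and $\mathrm{E}_{\xi}[\mathcal{G}(\mathbf{x};\xi)]\in\partial f(\mathbf{x})$ for every $\mathbf{x}$ (so, conditionally on $\xi_0,\dots,\xi_{k-1}$, the expectation of $\mathcal{G}(\mathbf{x}_k;\xi_k)$ lies in $\partial f(\mathbf{x}_k)$). SUM method with parameters $\alpha>0$, $\beta\in[0,1)$, $s\ge0$: given a deterministic $\mathbf{x}_0\in\mathbb{R}^d$, set $\mathbf{y}^s_0=\mathbf{x}_0$, and for $k=0,1,2,\dots$, with $\mathcal{G}_k=\mathcal{G}(\mathbf{x}_k;\xi_k)$, $$\mathbf{y}_{k+1}=\mathbf{x}_k-\alpha\mathcal{G}_k,\qquad \mathbf{y}^s_{k+1}=\mathbf{x}_k-s\alpha\mathcal{G}_k,\qquad \mathbf{x}_{k+1}=\mathbf{y}_{k+1}+\beta(\mathbf{y}^s_{k+1}-\mathbf{y}^s_k).$$ *)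

theory Defs
  imports "HOL-Probability.Probability"
begin

definition subdifferential :: "('a::real_inner \<Rightarrow> real) \<Rightarrow> 'a \<Rightarrow> 'a set" where
  "subdifferential f x = {v. \<forall>y. f y \<ge> f x + v \<bullet> (y - x)}"

text \<open>
  The measure \<open>D\<close> is the law of the noise \<open>\<xi>\<close>, so the Bochner integral
  below is the expectation of \<open>G x \<xi>\<close> with respect to \<open>\<xi>\<close>. Joint measurability
  makes the iterates of a stochastic method random variables; integrability excludes
  the default value 0 of the integral.
\<close>

definition stochastic_subgradient ::
  "('a::euclidean_space \<Rightarrow> real) \<Rightarrow> 'b measure \<Rightarrow> ('a \<Rightarrow> 'b \<Rightarrow> 'a) \<Rightarrow> bool" where
  "stochastic_subgradient f D G \<longleftrightarrow>
     case_prod G \<in> borel_measurable (borel \<Otimes>\<^sub>M D) \<and>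
     (\<forall>x. integrable D (G x) \<and> (\<integral>z. G x z \<partial>D) \<in> subdifferential f x)"

text \<open>
  For a realization \<open>\<xi>\<close> of the noise sequence, \<open>SUM_x\<close> and \<open>SUM_ys\<close> are
  the sequences $x_k$ and $y^s_k$, both started at \<open>x0\<close>. The sequence $y_k$,
  which has no initial value, is the local \<open>y\<close>.
\<close>

fun SUM_x :: "real \<Rightarrow> real \<Rightarrow> real \<Rightarrow> ('a::real_vector \<Rightarrow> 'b \<Rightarrow> 'a) \<Rightarrow> 'a \<Rightarrow> (nat \<Rightarrow> 'b) \<Rightarrow> nat \<Rightarrow> 'a"
and SUM_ys :: "real \<Rightarrow> real \<Rightarrow> real \<Rightarrow> ('a \<Rightarrow> 'b \<Rightarrow> 'a) \<Rightarrow> 'a \<Rightarrow> (nat \<Rightarrow> 'b) \<Rightarrow> nat \<Rightarrow> 'a" where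
  "SUM_x \<alpha> \<beta> s G x0 \<xi> 0 = x0"
| "SUM_x \<alpha> \<beta> s G x0 \<xi> (Suc k) =
     (let x = SUM_x \<alpha> \<beta> s G x0 \<xi> k;
          g = G x (\<xi> k);
          y = x - \<alpha> *\<^sub>R g;
          ys = x - (s * \<alpha>) *\<^sub>R g
      in y + \<beta> *\<^sub>R (ys - SUM_ys \<alpha> \<beta> s G x0 \<xi> k))"
| "SUM_ys \<alpha> \<beta> s G x0 \<xi> 0 = x0"
| "SUM_ys \<alpha> \<beta> s G x0 \<xi> (Suc k) =
     (let x = SUM_x \<alpha> \<beta> s G x0 \<xi> k
      in x - (s * \<alpha>) *\<^sub>R G x (\<xi> k))"

end

theory Submission
  imports Defs
begin

text \<open>
  The auxiliary points $z_k = x_k + \frac{\beta}{1-\beta}(x_k - y^s_k)$ satisfy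
  $z_{k+1} = z_k - \frac{\alpha}{1-\beta} g_k$, so the method is a plain subgradient step
  in $z$. Expanding $\|z_{k+1} - x_*\|^2$ produces the inner products of $g_k$ with
  $x_k - x_*$ and with $x_k - x_{k-1}$, which in expectation dominate the corresponding
  differences of $f$ since $g_k$ is a subgradient given the past, together with
  $\|g_k\|^2 - 2 s \beta \langle g_k, g_{k-1} \rangle$. The assumption $2 s \beta \ge 1$
  bounds the latter by $2 s \beta M \|g_k - g_{k-1}\|$. Summing telescopes both the
  distances and the differences $f(x_k) - f(x_{k-1})$.
\<close>

section \<open>Dependence of the iterates on the noise, measurability and boundedness\<close>

lemma SUM_x_SUM_ys_cong:
  assumes "\<And>i. i < k \<Longrightarrow> v i = w i"
  shows "SUM_x \<alpha> \<beta> s G x0 v k = SUM_x \<alpha> \<beta> s G x0 w k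
    \<and> SUM_ys \<alpha> \<beta> s G x0 v k = SUM_ys \<alpha> \<beta> s G x0 w k"
  using assms by (induction k) (auto simp: Let_def)

text \<open>Measurability is asked only of the noise before \<open>k\<close>, and \<open>N\<close>
  is arbitrary, so the lemma serves both the probability space itself and the finite product
  \<open>PiM {..<k}\<close> with its coordinate maps.\<close>

lemma measurable_SUM_x_SUM_ys:
  fixes G :: "'a::euclidean_space \<Rightarrow> 'b \<Rightarrow> 'a"
  assumes G: "case_prod G \<in> borel_measurable (borel \<Otimes>\<^sub>M D)"
    and "\<And>i. i < k \<Longrightarrow> \<xi> i \<in> measurable N D"
  shows "(\<lambda>\<omega>. SUM_x \<alpha> \<beta> s G x0 (\<lambda>i. \<xi> i \<omega>) k) \<in> borel_measurable N
    \<and> (\<lambda>\<omega>. SUM_ys \<alpha> \<beta> s G x0 (\<lambda>i. \<xi> i \<omega>) k) \<in> borel_measurable N"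
  using assms(2)
proof (induction k)
  case (Suc k)
  then have [measurable]:
    "(\<lambda>\<omega>. SUM_x \<alpha> \<beta> s G x0 (\<lambda>i. \<xi> i \<omega>) k) \<in> borel_measurable N"
    "(\<lambda>\<omega>. SUM_ys \<alpha> \<beta> s G x0 (\<lambda>i. \<xi> i \<omega>) k) \<in> borel_measurable N"
    "\<xi> k \<in> measurable N D"
    by auto
  have [measurable]:
    "(\<lambda>\<omega>. G (SUM_x \<alpha> \<beta> s G x0 (\<lambda>i. \<xi> i \<omega>) k) (\<xi> k \<omega>)) \<in> borel_measurable N"
    using measurable_compose[OF _ G, of "\<lambda>\<omega>. (SUM_x \<alpha> \<beta> s G x0 (\<lambda>i. \<xi> i \<omega>) k, \<xi> k \<omega>)" N]
    by simp
  show ?case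
    by (simp add: Let_def)
qed simp

text \<open>Each step adds only multiples of earlier points and of a gradient of norm at most
  \<open>M\<close>, so a bound survives the recursion. It may grow with \<open>k\<close>; what
  matters is that it is uniform in the noise, which later yields integrability.\<close>

lemma bounded_SUM_x_SUM_ys:
  fixes G :: "'a::real_normed_vector \<Rightarrow> 'b \<Rightarrow> 'a"
  assumes "\<And>u z. z \<in> Z \<Longrightarrow> norm (G u z) \<le> M"
  shows "\<exists>B. \<forall>w. range w \<subseteq> Z \<longrightarrow>
    norm (SUM_x \<alpha> \<beta> s G x0 w k) \<le> B \<and> norm (SUM_ys \<alpha> \<beta> s G x0 w k) \<le> B"
proof (induction k)
  case 0
  show ?case by auto
next
  case (Suc k)
  then obtain B where B: "\<And>w. range w \<subseteq> Z \<Longrightarrow>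
      norm (SUM_x \<alpha> \<beta> s G x0 w k) \<le> B \<and> norm (SUM_ys \<alpha> \<beta> s G x0 w k) \<le> B"
    by blast
  \<comment> \<open>\<open>C\<close> will bound the next auxiliary point and \<open>C'\<close> the
    next iterate; both are needed since the two sequences feed each other.\<close>
  define C where "C = B + \<bar>s * \<alpha>\<bar> * M"
  define C' where "C' = B + \<bar>\<alpha>\<bar> * M + \<bar>\<beta>\<bar> * (C + B)"
  have "norm (SUM_x \<alpha> \<beta> s G x0 w (Suc k)) \<le> max C C'
      \<and> norm (SUM_ys \<alpha> \<beta> s G x0 w (Suc k)) \<le> max C C'" if w: "range w \<subseteq> Z" for w
  proof -
    define x where "x = SUM_x \<alpha> \<beta> s G x0 w k"
    define y where "y = SUM_ys \<alpha> \<beta> s G x0 w k"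
    define g where "g = G x (w k)"
    have x: "norm x \<le> B" and y: "norm y \<le> B"
      using B[OF w] by (simp_all add: x_def y_def)
    have g: "norm g \<le> M"
      unfolding g_def by (rule assms) (use w in auto)
    have scale: "norm (c *\<^sub>R g) \<le> \<bar>c\<bar> * M" for c
      using g by (auto intro: mult_left_mono)
    have 1: "norm (x - (s * \<alpha>) *\<^sub>R g) \<le> C"
      using norm_triangle_ineq4[of x "(s * \<alpha>) *\<^sub>R g"] scale[of "s * \<alpha>"] x by (simp add: C_def)
    have "norm (x - (s * \<alpha>) *\<^sub>R g - y) \<le> C + B"
      using norm_triangle_ineq4[of "x - (s * \<alpha>) *\<^sub>R g" y] 1 y by simp
    then have "norm (\<beta> *\<^sub>R (x - (s * \<alpha>) *\<^sub>R g - y)) \<le> \<bar>\<beta>\<bar> * (C + B)"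
      by (auto intro: mult_left_mono)
    then have "norm (x - \<alpha> *\<^sub>R g + \<beta> *\<^sub>R (x - (s * \<alpha>) *\<^sub>R g - y)) \<le> C'"
      using norm_triangle_ineq[of "x - \<alpha> *\<^sub>R g" "\<beta> *\<^sub>R (x - (s * \<alpha>) *\<^sub>R g - y)"]
        norm_triangle_ineq4[of x "\<alpha> *\<^sub>R g"] scale[of \<alpha>] x
      by (simp add: C'_def)
    with 1 show ?thesis
      by (auto simp: Let_def x_def y_def g_def)
  qed
  then show ?case by blast
qed

section \<open>The distance recursion along a single realization\<close>

lemma SUM_ys_eq:
  "SUM_ys \<alpha> \<beta> s G x0 w k = SUM_x \<alpha> \<beta> s G x0 w (k - 1)
     - (s * \<alpha>) *\<^sub>R (if k = 0 then 0 else G (SUM_x \<alpha> \<beta> s G x0 w (k - 1)) (w (k - 1)))"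
  \<comment> \<open>For \<open>k = 0\<close> truncated subtraction gives \<open>k - 1 = 0\<close>,
    and the zero gradient matches the initialization of both sequences at \<open>x0\<close>.\<close>
  by (cases k) (auto simp: Let_def)

text \<open>One step with the indices stripped: \<open>x\<close>, \<open>y\<close>, \<open>g\<close>
  belong to time k, \<open>x'\<close> and \<open>h\<close> are the previous iterate and gradient,
  \<open>x1\<close> and \<open>y1\<close> the next points. The weight in front of the squared
  distances normalizes the coefficient of \<open>g \<bullet> (x - c)\<close> to 1.\<close>

lemma SUM_distance_step:
  fixes x y g h c :: "'a::real_inner"
  assumes "\<alpha> > 0" "\<beta> < 1" "s * \<beta> \<ge> 1 / 2" "norm g \<le> M"
    and y: "y = x' - (s * \<alpha>) *\<^sub>R h"
    and x1: "x1 = x - \<alpha> *\<^sub>R g + \<beta> *\<^sub>R (y1 - y)"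
    and y1: "y1 = x - (s * \<alpha>) *\<^sub>R g"
  shows "g \<bullet> (x - c) + \<beta> / (1 - \<beta>) * (g \<bullet> (x - x'))
      + (1 - \<beta>) / (2 * \<alpha>) * (norm (x1 + (\<beta> / (1 - \<beta>)) *\<^sub>R (x1 - y1) - c))\<^sup>2
    \<le> (1 - \<beta>) / (2 * \<alpha>) * (norm (x + (\<beta> / (1 - \<beta>)) *\<^sub>R (x - y) - c))\<^sup>2
      + s * \<alpha> * \<beta> * M / (1 - \<beta>) * norm (g - h)"
proof -
  define p where "p = \<beta> / (1 - \<beta>)"
  define a where "a = \<alpha> / (1 - \<beta>)"
  define z where "z = x + p *\<^sub>R (x - y)"
  \<comment> \<open>Both identities say that 1 + p is the reciprocal of 1 - \<beta>. The first makes
    \<open>y1\<close> cancel from the new auxiliary point; the second gives its step size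
    \<open>a\<close>.\<close>
  have a: "a > 0" and p: "(1 + p) * \<beta> = p" "(1 + p) * \<alpha> = a"
    using assms by (auto simp: a_def p_def field_simps)
  have half: "(1 - \<beta>) / (2 * \<alpha>) = 1 / (2 * a)"
    using assms by (simp add: a_def)
  have "x1 + p *\<^sub>R (x1 - y1) = (1 + p) *\<^sub>R x1 - p *\<^sub>R y1"
    by (simp add: algebra_simps)
  also have "\<dots> = (1 + p) *\<^sub>R x - ((1 + p) * \<alpha>) *\<^sub>R g
      + ((1 + p) * \<beta>) *\<^sub>R (y1 - y) - p *\<^sub>R y1"
    by (simp add: x1 scaleR_add_right scaleR_diff_right)
  also have "\<dots> = z - a *\<^sub>R g"
    unfolding p z_def by (simp add: algebra_simps)
  finally have z1: "x1 + p *\<^sub>R (x1 - y1) = z - a *\<^sub>R g" .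
  have "(norm (z - a *\<^sub>R g - c))\<^sup>2 = (norm (z - c))\<^sup>2 - 2 * a * (g \<bullet> (z - c)) + a\<^sup>2 * (norm g)\<^sup>2"
    unfolding power2_norm_eq_inner
    by (simp add: algebra_simps inner_commute power2_eq_square)
  then have 1: "1 / (2 * a) * (norm (z - a *\<^sub>R g - c))\<^sup>2
      = 1 / (2 * a) * (norm (z - c))\<^sup>2 - g \<bullet> (z - c) + a / 2 * (norm g)\<^sup>2"
    using a by (simp add: field_simps power2_eq_square)
  \<comment> \<open>Inserting the formula for \<open>y\<close> splits x - y into the displacement
    from the previous iterate and a multiple of the previous gradient; the latter produces the cross
    term.\<close>
  have 2: "g \<bullet> (z - c) = g \<bullet> (x - c) + p * (g \<bullet> (x - x')) + p * s * \<alpha> * (g \<bullet> h)"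
    by (simp add: z_def y algebra_simps)
  \<comment> \<open>Raising the coefficient of the square to that of the cross term lets the two
    combine into \<open>g \<bullet> (g - h)\<close>, to which Cauchy-Schwarz applies.\<close>
  have "(norm g)\<^sup>2 \<le> 2 * (s * \<beta>) * (norm g)\<^sup>2"
    using assms(3) mult_right_mono[of 1 "2 * (s * \<beta>)" "(norm g)\<^sup>2"] by simp
  then have "(norm g)\<^sup>2 - 2 * (s * \<beta>) * (g \<bullet> h) \<le> 2 * (s * \<beta>) * (g \<bullet> (g - h))"
    by (simp add: power2_norm_eq_inner algebra_simps)
  also have "\<dots> \<le> 2 * (s * \<beta>) * (M * norm (g - h))"
  proof (rule mult_left_mono)
    show "g \<bullet> (g - h) \<le> M * norm (g - h)"
      using norm_cauchy_schwarz[of g "g - h"] mult_right_mono[OF \<open>norm g \<le> M\<close>, of "norm (g - h)"]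
      by simp
  qed (use assms(3) in simp)
  finally have "a / 2 * ((norm g)\<^sup>2 - 2 * (s * \<beta>) * (g \<bullet> h)) \<le> a / 2 * (2 * (s * \<beta>) * (M * norm (g - h)))"
    using a by (intro mult_left_mono) auto
  moreover have "a / 2 * ((norm g)\<^sup>2 - 2 * (s * \<beta>) * (g \<bullet> h))
      = a / 2 * (norm g)\<^sup>2 - (a * \<beta>) * s * (g \<bullet> h)"
    by (simp add: algebra_simps)
  moreover have "(a * \<beta>) * s * (g \<bullet> h) = p * s * \<alpha> * (g \<bullet> h)"
    by (simp add: a_def p_def)
  moreover have "a / 2 * (2 * (s * \<beta>) * (M * norm (g - h)))
      = s * \<alpha> * \<beta> * M / (1 - \<beta>) * norm (g - h)"
    using assms(2) by (simp add: a_def field_simps)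
  ultimately have 3: "a / 2 * (norm g)\<^sup>2 - p * s * \<alpha> * (g \<bullet> h)
      \<le> s * \<alpha> * \<beta> * M / (1 - \<beta>) * norm (g - h)"
    by linarith
  show ?thesis
    unfolding half p_def[symmetric] z1 z_def[symmetric] using 1 2 3 by linarith
qed

lemma SUM_distance_sum:
  fixes G :: "'a::real_inner \<Rightarrow> 'b \<Rightarrow> 'a"
  assumes "\<alpha> > 0" "\<beta> < 1" "s * \<beta> \<ge> 1 / 2"
    and x: "\<And>k. x k = SUM_x \<alpha> \<beta> s G x0 w k"
    and g: "\<And>k. g k = G (x k) (w k)"
    and M: "\<And>k. norm (g k) \<le> M"
  shows "(\<Sum>k=0..t. g k \<bullet> (x k - c) + \<beta> / (1 - \<beta>) * (g k \<bullet> (x k - x (k - 1))))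
    \<le> (1 - \<beta>) / (2 * \<alpha>) * (norm (x0 - c))\<^sup>2
      + s * \<alpha> * \<beta> * M / (1 - \<beta>) * (\<Sum>k=0..t. norm (g k - (if k = 0 then 0 else g (k - 1))))"
proof -
  define y where "y k = SUM_ys \<alpha> \<beta> s G x0 w k" for k
  \<comment> \<open>The potential that telescopes: the weighted squared distance of the auxiliary
    point to \<open>c\<close>.\<close>
  define V where
    "V k = (1 - \<beta>) / (2 * \<alpha>) * (norm (x k + (\<beta> / (1 - \<beta>)) *\<^sub>R (x k - y k) - c))\<^sup>2" for k
  have step: "g k \<bullet> (x k - c) + \<beta> / (1 - \<beta>) * (g k \<bullet> (x k - x (k - 1))) + V (Suc k)
      \<le> V k + s * \<alpha> * \<beta> * M / (1 - \<beta>) * norm (g k - (if k = 0 then 0 else g (k - 1)))" for k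
    unfolding V_def
  proof (rule SUM_distance_step)
    show "y k = x (k - 1) - (s * \<alpha>) *\<^sub>R (if k = 0 then 0 else g (k - 1))"
      unfolding y_def x g by (rule SUM_ys_eq)
  qed (use assms in \<open>auto simp: x g y_def Let_def\<close>)
  \<comment> \<open>The final potential is kept on the left so that the induction closes; it is
    dropped afterwards by nonnegativity.\<close>
  have "(\<Sum>k=0..t. g k \<bullet> (x k - c) + \<beta> / (1 - \<beta>) * (g k \<bullet> (x k - x (k - 1)))) + V (Suc t)
    \<le> V 0 + s * \<alpha> * \<beta> * M / (1 - \<beta>) * (\<Sum>k=0..t. norm (g k - (if k = 0 then 0 else g (k - 1))))"
  proof (induction t)
    case 0
    show ?case using step[of 0] by simp
  next
    case (Suc t)
    then show ?case
      using step[of "Suc t"] by (simp add: algebra_simps)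
  qed
  moreover have "V (Suc t) \<ge> 0"
    using assms by (simp add: V_def)
  moreover have "V 0 = (1 - \<beta>) / (2 * \<alpha>) * (norm (x0 - c))\<^sup>2"
    by (simp add: V_def x y_def)
  ultimately show ?thesis by linarith
qed

section \<open>Independence of past and present noise, and the subgradient inequality in
  expectation\<close>

lemma (in prob_space) distr_past_present:
  fixes \<xi> :: "nat \<Rightarrow> 'a \<Rightarrow> 'b"
  assumes indep: "indep_vars (\<lambda>_. D) \<xi> UNIV" and D: "distr M D (\<xi> k) = D"
  shows "distr M (PiM {..<k} (\<lambda>_. D)) (\<lambda>\<omega>. \<lambda>i\<in>{..<k}. \<xi> i \<omega>) \<Otimes>\<^sub>M D
    = distr M (PiM {..<k} (\<lambda>_. D) \<Otimes>\<^sub>M D) (\<lambda>\<omega>. (\<lambda>i\<in>{..<k}. \<xi> i \<omega>, \<xi> k \<omega>))"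
proof -
  let ?N = "PiM {..<k} (\<lambda>_. D)" and ?K = "PiM {k} (\<lambda>_. D)"
  let ?W = "\<lambda>\<omega>. \<lambda>i\<in>{..<k}. \<xi> i \<omega>" and ?Z = "\<lambda>\<omega>. \<lambda>i\<in>{k}. \<xi> i \<omega>"
  \<comment> \<open>Restrictions of an independent family to disjoint index sets are independent.
    The present appears as a one-coordinate tuple, to be unwrapped by evaluation at
    \<open>k\<close>.\<close>
  have "indep_var ?N ?W ?K ?Z"
    by (rule indep_var_restrict[OF indep]) auto
  then have [measurable]: "?W \<in> measurable M ?N" "?Z \<in> measurable M ?K"
    and joint: "distr M ?N ?W \<Otimes>\<^sub>M distr M ?K ?Z = distr M (?N \<Otimes>\<^sub>M ?K) (\<lambda>\<omega>. (?W \<omega>, ?Z \<omega>))"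
    by (simp_all add: indep_var_distribution_eq)
  have proj[measurable]: "(\<lambda>w. w k) \<in> measurable ?K D"
    by simp
  have "distr (distr M ?K ?Z) D (\<lambda>w. w k) = distr M D (\<xi> k)"
    by (subst distr_distr) (simp_all add: o_def)
  with D have Z: "distr (distr M ?K ?Z) D (\<lambda>w. w k) = D"
    by simp
  have "\<xi> k \<in> measurable M D"
    using indep by (simp add: indep_vars_def)
  then interpret D: prob_space D
    using prob_space_distr[of "\<xi> k" D] D by simp
  \<comment> \<open>Both factors are written as images, the first under the identity, so that the
    product of images becomes the image of the product.\<close>
  have "distr M ?N ?W \<Otimes>\<^sub>M D = distr (distr M ?N ?W) ?N (\<lambda>w. w) \<Otimes>\<^sub>M distr (distr M ?K ?Z) D (\<lambda>w. w k)"
    unfolding Z by (simp add: distr_distr o_def)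
  also have "\<dots> = distr (distr M ?N ?W \<Otimes>\<^sub>M distr M ?K ?Z) (?N \<Otimes>\<^sub>M D) (\<lambda>(v, w). (v, w k))"
    by (rule pair_measure_distr) (simp_all add: Z D.sigma_finite_measure_axioms)
  also have "\<dots> = distr M (?N \<Otimes>\<^sub>M D) (\<lambda>\<omega>. (?W \<omega>, \<xi> k \<omega>))"
    unfolding joint by (subst distr_distr) (simp_all add: o_def)
  finally show ?thesis .
qed

text \<open>Fubini replaces conditional expectation: \<open>joint\<close> encodes independence of
  the past \<open>W\<close> from the fresh noise \<open>Z\<close>. With the past fixed, averaging
  over \<open>Z\<close> turns \<open>G\<close> into a true subgradient at \<open>u\<close>, whose
  inequality is tested at \<open>v\<close>.\<close>

lemma (in prob_space) expectation_stochastic_subgradient: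
  fixes f :: "'c::euclidean_space \<Rightarrow> real" and G :: "'c \<Rightarrow> 'b \<Rightarrow> 'c"
  assumes G: "stochastic_subgradient f D G"
    and W[measurable]: "random_variable N W" and Z[measurable]: "random_variable D Z"
    and D: "distr M D Z = D"
    and joint: "distr M N W \<Otimes>\<^sub>M D = distr M (N \<Otimes>\<^sub>M D) (\<lambda>\<omega>. (W \<omega>, Z \<omega>))"
    and u[measurable]: "u \<in> borel_measurable N" and v[measurable]: "v \<in> borel_measurable N"
    and f[measurable]: "f \<in> borel_measurable borel"
    and int1: "integrable M (\<lambda>\<omega>. G (u (W \<omega>)) (Z \<omega>) \<bullet> (u (W \<omega>) - v (W \<omega>)))"
    and int2: "integrable M (\<lambda>\<omega>. f (u (W \<omega>)) - f (v (W \<omega>)))"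
  shows "expectation (\<lambda>\<omega>. f (u (W \<omega>)) - f (v (W \<omega>)))
    \<le> expectation (\<lambda>\<omega>. G (u (W \<omega>)) (Z \<omega>) \<bullet> (u (W \<omega>) - v (W \<omega>)))"
proof -
  define h where "h = (\<lambda>(w, z). G (u w) z \<bullet> (u w - v w))"
  have intG: "integrable D (G c)" and sub: "(\<integral>z. G c z \<partial>D) \<in> subdifferential f c" for c
    using G by (auto simp: stochastic_subgradient_def)
  have [measurable]: "case_prod G \<in> borel_measurable (borel \<Otimes>\<^sub>M D)"
    using G by (simp add: stochastic_subgradient_def)
  have "(\<lambda>(w, z). G (u w) z) \<in> borel_measurable (N \<Otimes>\<^sub>M D)"
    using measurable_compose[of "\<lambda>(w, z). (u w, z)" "N \<Otimes>\<^sub>M D" "borel \<Otimes>\<^sub>M D" "case_prod G" borel]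
    by (simp add: case_prod_beta')
  then have h[measurable]: "h \<in> borel_measurable (N \<Otimes>\<^sub>M D)"
    unfolding h_def case_prod_beta' by simp
  interpret W: prob_space "distr M N W" by (rule prob_space_distr) simp
  interpret D: prob_space D using prob_space_distr[of Z D] D by simp
  interpret pair_sigma_finite "distr M N W" D ..
  have int_h: "integrable (distr M N W \<Otimes>\<^sub>M D) h"
    unfolding joint by (subst integrable_distr_eq) (use int1 in \<open>simp_all add: h_def\<close>)
  have "expectation (\<lambda>\<omega>. f (u (W \<omega>)) - f (v (W \<omega>))) = (\<integral>w. f (u w) - f (v w) \<partial>distr M N W)"
    by (subst integral_distr) simp_all
  also have "\<dots> \<le> (\<integral>w. (\<integral>z. h (w, z) \<partial>D) \<partial>distr M N W)"
  proof (rule integral_mono)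
    show "integrable (distr M N W) (\<lambda>w. f (u w) - f (v w))"
      by (subst integrable_distr_eq) (use int2 in simp_all)
    show "integrable (distr M N W) (\<lambda>w. \<integral>z. h (w, z) \<partial>D)"
      by (rule integrable_fst'[OF int_h])
    fix w
    \<comment> \<open>Integrability of \<open>G (u w)\<close> lets the integral pass inside the
      inner product.\<close>
    have "(\<integral>z. h (w, z) \<partial>D) = (\<integral>z. G (u w) z \<partial>D) \<bullet> (u w - v w)"
      by (simp add: h_def intG)
    moreover have "f (v w) \<ge> f (u w) + (\<integral>z. G (u w) z \<partial>D) \<bullet> (v w - u w)"
      using sub[of "u w"] by (simp add: subdifferential_def)
    ultimately show "f (u w) - f (v w) \<le> (\<integral>z. h (w, z) \<partial>D)"
      by (simp add: inner_diff_right)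
  qed
  also have "\<dots> = integral\<^sup>L (distr M N W \<Otimes>\<^sub>M D) h"
    by (rule integral_fst'[OF int_h])
  also have "\<dots> = expectation (\<lambda>\<omega>. G (u (W \<omega>)) (Z \<omega>) \<bullet> (u (W \<omega>) - v (W \<omega>)))"
    unfolding joint by (subst integral_distr) (simp_all add: h_def)
  finally show ?thesis .
qed

section \<open>Averaging and telescoping\<close>

lemma convex_on_average_le:
  fixes f :: "'a::real_vector \<Rightarrow> real"
  assumes "convex_on UNIV f"
  shows "(real t + 1) * f ((1 / (real t + 1)) *\<^sub>R (\<Sum>k=0..t. x k)) \<le> (\<Sum>k=0..t. f (x k))"
proof -
  have "f (\<Sum>k=0..t. (1 / (real t + 1)) *\<^sub>R x k) \<le> (\<Sum>k=0..t. 1 / (real t + 1) * f (x k))"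
    by (rule convex_on_sum[OF _ _ assms]) auto
  then show ?thesis
    by (simp add: scaleR_sum_right[symmetric] sum_divide_distrib[symmetric] field_simps)
qed

text \<open>The term at index 0 vanishes by truncated subtraction, so the remaining terms telescope
  as usual.\<close>

lemma sum_diff_pred:
  fixes F :: "nat \<Rightarrow> 'a::ab_group_add"
  shows "(\<Sum>k=0..t. F k - F (k - 1)) = F t - F 0"
  by (induction t) auto

theorem theorem2:
  fixes f :: "real ^ 'd \<Rightarrow> real"
    and G :: "real ^ 'd \<Rightarrow> 'b \<Rightarrow> real ^ 'd"
    and D :: "'b measure"
    and P :: "'w measure"
    and \<xi> :: "nat \<Rightarrow> 'w \<Rightarrow> 'b"
    and x g :: "nat \<Rightarrow> 'w \<Rightarrow> real ^ 'd"
    and x0 x_star :: "real ^ 'd"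
    and \<alpha> \<beta> s M :: real
    and t :: nat
  assumes "convex_on UNIV f"
    and "prob_space P"
    and "prob_space.indep_vars P (\<lambda>_. D) \<xi> UNIV"
    and "\<And>k. distr P D (\<xi> k) = D"
    and "stochastic_subgradient f D G"
    and "\<And>u z. z \<in> space D \<Longrightarrow> norm (G u z) \<le> M"
    and "\<And>u. f x_star \<le> f u"
    and "\<alpha> > 0" and "0 \<le> \<beta>" and "\<beta> < 1" and "s \<ge> 0" and "s * \<beta> \<ge> 1 / 2"
    and "\<And>k \<omega>. x k \<omega> = SUM_x \<alpha> \<beta> s G x0 (\<lambda>i. \<xi> i \<omega>) k"
    and "\<And>k \<omega>. g k \<omega> = G (x k \<omega>) (\<xi> k \<omega>)"
  shows "prob_space.expectation P
           (\<lambda>\<omega>. f ((1 / (real t + 1)) *\<^sub>R (\<Sum>k=0..t. x k \<omega>)) - f x_star)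
         \<le> \<beta> * (f x0 - f x_star) / ((1 - \<beta>) * (real t + 1))
           + (1 - \<beta>) * (norm (x0 - x_star))\<^sup>2 / (2 * \<alpha> * (real t + 1))
           + s * \<alpha> * \<beta> * M / (1 - \<beta>)
             * (prob_space.expectation P
                  (\<lambda>\<omega>. \<Sum>k=0..t. norm (g k \<omega> - (if k = 0 then 0 else g (k - 1) \<omega>)))
                / (real t + 1))"
proof -

  \<comment> \<open>Measurability of iterates and gradients\<close>
  interpret prob_space P by fact
  note \<xi>_indep = assms(3) and \<xi>_distr = assms(4) and sg = assms(5) and G_le = assms(6)
    and min = assms(7) and x_def = assms(13) and g_def = assms(14)
  have \<xi>_meas[measurable]: "\<xi> k \<in> measurable P D" for k
    using \<xi>_indep by (simp add: indep_vars_def)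
  have G_meas: "case_prod G \<in> borel_measurable (borel \<Otimes>\<^sub>M D)"
    using sg by (simp add: stochastic_subgradient_def)
  \<comment> \<open>A finite convex function on a finite-dimensional space is continuous; this
    yields measurability here and boundedness on balls below.\<close>
  have f_cont: "continuous_on UNIV f"
    by (rule convex_on_continuous) (use assms(1) in auto)
  have f_meas[measurable]: "f \<in> borel_measurable borel"
    by (rule borel_measurable_continuous_onI[OF f_cont])
  have x_meas[measurable]: "x k \<in> borel_measurable P" for k
    using measurable_SUM_x_SUM_ys[OF G_meas, of k \<xi> P] by (simp add: x_def[abs_def])
  have g_meas[measurable]: "g k \<in> borel_measurable P" for k
    using measurable_compose[OF _ G_meas, of "\<lambda>\<omega>. (x k \<omega>, \<xi> k \<omega>)" P]
    by (simp add: g_def[abs_def])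
  have \<xi>_space: "\<xi> k \<omega> \<in> space D" if "\<omega> \<in> space P" for k \<omega>
    using measurable_space[OF \<xi>_meas that] .
  have g_le: "norm (g k \<omega>) \<le> M" if "\<omega> \<in> space P" for k \<omega>
    using G_le \<xi>_space[OF that] by (simp add: g_def)

  \<comment> \<open>Integrability from uniform bounds\<close>
  have "\<exists>B. \<forall>\<omega>\<in>space P. norm (x k \<omega>) \<le> B" for k
    using bounded_SUM_x_SUM_ys[of "space D" G M \<alpha> \<beta> s x0 k] G_le \<xi>_space
    unfolding x_def by (metis image_subset_iff)
  then obtain B where B: "\<And>k \<omega>. \<omega> \<in> space P \<Longrightarrow> norm (x k \<omega>) \<le> B k"
    by metis
  have f_bdd: "\<exists>C. \<forall>u\<in>cball 0 R. norm (f u) \<le> C" for R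
  proof -
    have "compact (f ` cball 0 R)"
      by (rule compact_continuous_image[OF continuous_on_subset[OF f_cont]]) auto
    then show ?thesis
      using compact_imp_bounded[of "f ` cball 0 R"] by (auto simp: bounded_iff)
  qed
  have int_f: "integrable P (\<lambda>\<omega>. f (u \<omega>))"
    if [measurable]: "u \<in> borel_measurable P" and u: "\<And>\<omega>. \<omega> \<in> space P \<Longrightarrow> norm (u \<omega>) \<le> R" for u R
  proof -
    obtain C where "\<And>v. v \<in> cball 0 R \<Longrightarrow> norm (f v) \<le> C"
      using f_bdd by blast
    then show ?thesis
      by (intro integrable_const_bound[where B = C] AE_I2) (use u in auto)
  qed
  have int_fx: "integrable P (\<lambda>\<omega>. f (x k \<omega>))" for k
    by (rule int_f[OF x_meas B])
  have int_inner: "integrable P (\<lambda>\<omega>. g k \<omega> \<bullet> (x k \<omega> - u \<omega>))"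
    if [measurable]: "u \<in> borel_measurable P" and u: "\<And>\<omega>. \<omega> \<in> space P \<Longrightarrow> norm (u \<omega>) \<le> R" for u R k
  proof (rule integrable_const_bound[where B = "M * (B k + R)"], rule AE_I2)
    fix \<omega> assume \<omega>: "\<omega> \<in> space P"
    have "norm (g k \<omega> \<bullet> (x k \<omega> - u \<omega>)) \<le> norm (g k \<omega>) * norm (x k \<omega> - u \<omega>)"
      using Cauchy_Schwarz_ineq2 by simp
    also have "\<dots> \<le> M * (B k + R)"
      using g_le[OF \<omega>, of k] B[OF \<omega>, of k] u[OF \<omega>] norm_triangle_ineq4[of "x k \<omega>" "u \<omega>"]
      by (intro mult_mono) (auto intro: order_trans[OF norm_ge_zero])
    finally show "norm (g k \<omega> \<bullet> (x k \<omega> - u \<omega>)) \<le> M * (B k + R)" .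
  qed simp

  \<comment> \<open>Subgradient inequalities given the past\<close>
  define past where "past k = (\<lambda>\<omega>. \<lambda>i\<in>{..<k}. \<xi> i \<omega>)" for k
  define X where "X j = (\<lambda>w. SUM_x \<alpha> \<beta> s G x0 w j)" for j
  \<comment> \<open>The iterate at time \<open>j\<close> reads only the noise before
    \<open>j\<close>, so cutting the sequence off at \<open>k\<close>, with \<open>undefined\<close>
    beyond, does not change it.\<close>
  have X_past: "X j (past k \<omega>) = x j \<omega>" if "j \<le> k" for j k \<omega>
    using SUM_x_SUM_ys_cong[where v = "past k \<omega>" and w = "\<lambda>i. \<xi> i \<omega>" and k = j and G = G] that by (simp add: X_def x_def past_def)
  have X_meas: "X j \<in> borel_measurable (PiM {..<k} (\<lambda>_. D))" if "j \<le> k" for j k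
    using measurable_SUM_x_SUM_ys[OF G_meas, of j "\<lambda>i w. w i" "PiM {..<k} (\<lambda>_. D)"] that
    by (simp add: X_def)
  have past_meas: "past k \<in> measurable P (PiM {..<k} (\<lambda>_. D))" for k
    unfolding past_def by simp
  have past_joint: "distr P (PiM {..<k} (\<lambda>_. D)) (past k) \<Otimes>\<^sub>M D
      = distr P (PiM {..<k} (\<lambda>_. D) \<Otimes>\<^sub>M D) (\<lambda>\<omega>. (past k \<omega>, \<xi> k \<omega>))" for k
    unfolding past_def by (rule distr_past_present[OF \<xi>_indep \<xi>_distr])
  note subgradient = expectation_stochastic_subgradient
    [OF sg past_meas \<xi>_meas \<xi>_distr past_joint]
  have sub_star: "expectation (\<lambda>\<omega>. f (x k \<omega>) - f x_star)
      \<le> expectation (\<lambda>\<omega>. g k \<omega> \<bullet> (x k \<omega> - x_star))" for k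
    using subgradient[of "X k" k "\<lambda>_. x_star"] X_meas[of k k] int_fx int_inner[of "\<lambda>_. x_star" "norm x_star"]
    by (simp add: X_past g_def)
  \<comment> \<open>The previous iterate is also a function of the past, hence an admissible test
    point. At \<open>k = 0\<close> both sides are 0.\<close>
  have sub_pred: "expectation (\<lambda>\<omega>. f (x k \<omega>) - f (x (k - 1) \<omega>))
      \<le> expectation (\<lambda>\<omega>. g k \<omega> \<bullet> (x k \<omega> - x (k - 1) \<omega>))" for k
    using subgradient[of "X k" k "X (k - 1)"] X_meas[of k k] X_meas[of "k - 1" k] int_fx
      int_inner[OF x_meas B]
    by (simp add: X_past g_def)

  \<comment> \<open>Summation and the final estimate\<close>
  define p where "p = \<beta> / (1 - \<beta>)"
  define c where "c = s * \<alpha> * \<beta> * M / (1 - \<beta>)"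
  define Q where "Q = (\<lambda>\<omega>. \<Sum>k=0..t. norm (g k \<omega> - (if k = 0 then 0 else g (k - 1) \<omega>)))"
  define avg where "avg = (\<lambda>\<omega>. (1 / (real t + 1)) *\<^sub>R (\<Sum>k=0..t. x k \<omega>))"
  have p: "p \<ge> 0"
    using assms by (simp add: p_def)
  have int_g: "integrable P (g k)" for k
    by (rule integrable_const_bound[where B = M]) (auto intro!: AE_I2 g_le)
  have int_prev: "integrable P (\<lambda>\<omega>. if k = 0 then 0 else g (k - 1) \<omega>)" for k
    using int_g by (cases "k = 0") auto
  have int_Q: "integrable P Q"
    unfolding Q_def by (auto intro!: Bochner_Integration.integrable_sum integrable_norm
        Bochner_Integration.integrable_diff int_g int_prev)
  have int_avg: "integrable P (\<lambda>\<omega>. f (avg \<omega>))"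
  proof (rule int_f)
    show "avg \<in> borel_measurable P"
      unfolding avg_def by simp
    show "norm (avg \<omega>) \<le> 1 / (real t + 1) * (\<Sum>k=0..t. B k)" if "\<omega> \<in> space P" for \<omega>
      unfolding avg_def norm_scaleR using that
      by (intro mult_mono sum_norm_le B) (auto intro: sum_nonneg)
  qed
  note ints = int_fx int_inner[of "\<lambda>_. x_star" "norm x_star", simplified] int_inner[OF x_meas B]

  \<comment> \<open>Jensen handles the gaps to the minimum. The differences weighted by
    \<open>p\<close> telescope to f(x_t) - f(x_0), bounded below by minimality; this is the origin
    of the term with the initial gap.\<close>
  have pathwise: "(real t + 1) * (f (avg \<omega>) - f x_star) - p * (f x0 - f x_star)
      \<le> (\<Sum>k=0..t. (f (x k \<omega>) - f x_star) + p * (f (x k \<omega>) - f (x (k - 1) \<omega>)))" for \<omega>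
  proof -
    have "(\<Sum>k=0..t. (f (x k \<omega>) - f x_star) + p * (f (x k \<omega>) - f (x (k - 1) \<omega>)))
        = (\<Sum>k=0..t. f (x k \<omega>) - f x_star) + p * (\<Sum>k=0..t. f (x k \<omega>) - f (x (k - 1) \<omega>))"
      by (simp only: sum.distrib sum_distrib_left)
    also have "\<dots> = (\<Sum>k=0..t. f (x k \<omega>)) - (real t + 1) * f x_star + p * (f (x t \<omega>) - f x0)"
      unfolding sum_diff_pred[of "\<lambda>k. f (x k \<omega>)" t]
      by (simp add: sum_subtractf x_def[of 0] algebra_simps)
    finally have "(\<Sum>k=0..t. (f (x k \<omega>) - f x_star) + p * (f (x k \<omega>) - f (x (k - 1) \<omega>)))
        = (\<Sum>k=0..t. f (x k \<omega>)) - (real t + 1) * f x_star + p * (f (x t \<omega>) - f x0)" .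
    moreover have "p * f (x t \<omega>) \<ge> p * f x_star"
      using min p by (intro mult_left_mono) auto
    ultimately show ?thesis
      using convex_on_average_le[OF assms(1), of t "\<lambda>k. x k \<omega>"]
      by (simp add: avg_def algebra_simps)
  qed
  have "(real t + 1) * expectation (\<lambda>\<omega>. f (avg \<omega>) - f x_star) - p * (f x0 - f x_star)
      = expectation (\<lambda>\<omega>. (real t + 1) * (f (avg \<omega>) - f x_star) - p * (f x0 - f x_star))"
    using int_avg by (simp add: prob_space)
  also have "\<dots> \<le> expectation (\<lambda>\<omega>. \<Sum>k=0..t. (f (x k \<omega>) - f x_star)
      + p * (f (x k \<omega>) - f (x (k - 1) \<omega>)))"
    by (rule integral_mono) (use int_avg int_fx pathwise in auto)
  also have "\<dots> = (\<Sum>k=0..t. expectation (\<lambda>\<omega>. f (x k \<omega>) - f x_star)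
      + p * expectation (\<lambda>\<omega>. f (x k \<omega>) - f (x (k - 1) \<omega>)))"
    using int_fx by (simp add: Bochner_Integration.integral_sum)
  \<comment> \<open>Function gaps are traded for inner products under the expectation, since a
    single sample of \<open>G\<close> need not be a subgradient.\<close>
  also have "\<dots> \<le> (\<Sum>k=0..t. expectation (\<lambda>\<omega>. g k \<omega> \<bullet> (x k \<omega> - x_star))
      + p * expectation (\<lambda>\<omega>. g k \<omega> \<bullet> (x k \<omega> - x (k - 1) \<omega>)))"
    by (intro sum_mono add_mono mult_left_mono sub_star sub_pred p)
  also have "\<dots> = expectation (\<lambda>\<omega>. \<Sum>k=0..t. g k \<omega> \<bullet> (x k \<omega> - x_star)
      + p * (g k \<omega> \<bullet> (x k \<omega> - x (k - 1) \<omega>)))"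
    using ints by (simp add: Bochner_Integration.integral_sum)
  \<comment> \<open>From here the bound is deterministic for each outcome in \<open>space P\<close>,
    where the noise lies in \<open>space D\<close> and the gradients are bounded by
    \<open>M\<close>.\<close>
  also have "\<dots> \<le> expectation (\<lambda>\<omega>. (1 - \<beta>) / (2 * \<alpha>) * (norm (x0 - x_star))\<^sup>2 + c * Q \<omega>)"
  proof (rule integral_mono)
    fix \<omega> assume \<omega>: "\<omega> \<in> space P"
    show "(\<Sum>k=0..t. g k \<omega> \<bullet> (x k \<omega> - x_star) + p * (g k \<omega> \<bullet> (x k \<omega> - x (k - 1) \<omega>)))
        \<le> (1 - \<beta>) / (2 * \<alpha>) * (norm (x0 - x_star))\<^sup>2 + c * Q \<omega>"
      unfolding p_def c_def Q_def
      by (rule SUM_distance_sum[where w = "\<lambda>i. \<xi> i \<omega>" and G = G])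
        (use assms x_def g_def g_le[OF \<omega>] in auto)
  qed (use ints int_Q in auto)
  also have "\<dots> = (1 - \<beta>) / (2 * \<alpha>) * (norm (x0 - x_star))\<^sup>2 + c * expectation Q"
    using int_Q by (simp add: prob_space)
  finally have "(real t + 1) * expectation (\<lambda>\<omega>. f (avg \<omega>) - f x_star)
      \<le> p * (f x0 - f x_star) + (1 - \<beta>) / (2 * \<alpha>) * (norm (x0 - x_star))\<^sup>2 + c * expectation Q"
    by simp
  then have "expectation (\<lambda>\<omega>. f (avg \<omega>) - f x_star)
      \<le> (p * (f x0 - f x_star) + (1 - \<beta>) / (2 * \<alpha>) * (norm (x0 - x_star))\<^sup>2 + c * expectation Q)
        / (real t + 1)"
    by (simp add: pos_le_divide_eq mult.commute)
  then show ?thesis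
    unfolding avg_def Q_def p_def c_def by (simp add: add_divide_distrib)
qed

end
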